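(* If $G$ is a connected claw-free cubic graph not isomorphic to $K_4$, then $\chi_2^f(G)=3$.
   Context: All graphs are finite and simple. A graph is cubic if it is $3$-regular, and claw-free if it has no induced subgraph isomorphic to $K_{1,3}$. A $2$-frugal coloring of $G$ is a proper vertex coloring in which no color appears more than twice in the (open) neighborhood of any vertex; $\chi_2^f(G)$ is the minimum number of colors in a $2$-frugal coloring of $G$. *)

theory Defs
  imports "Graph_Theory.Graph_Theory"
begin

text \<open>
  A finite simple graph is a digraph satisfying the locale \<^locale>\<open>graph\<close> (finite, symmetric, no
  loops, no parallel arcs): an undirected edge \<open>uv\<close> is the pair of arcs from \<open>u\<close> to \<open>v\<close> and from
  \<open>v\<close> to \<open>u\<close>.  The library predicates \<^const>\<open>complete_digraph\<close> and
  \<^const>\<open>complete_bipartite_digraph\<close> hold of every isomorphic copy of the respective graph.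
\<close>

definition neighborhood :: "('a, 'b) pre_digraph \<Rightarrow> 'a \<Rightarrow> 'a set" where
  "neighborhood G v = {u. v \<rightarrow>\<^bsub>G\<^esub> u}"

text \<open>Each edge at \<open>v\<close> contributes exactly one outgoing arc, so the degree of \<open>v\<close> is its out-degree.\<close>

definition regular :: "nat \<Rightarrow> ('a, 'b) pre_digraph \<Rightarrow> bool" where
  "regular d G \<longleftrightarrow> (\<forall>v \<in> verts G. out_degree G v = d)"

abbreviation cubic :: "('a, 'b) pre_digraph \<Rightarrow> bool" where
  "cubic \<equiv> regular 3"

definition claw_free :: "('a, 'b) pre_digraph \<Rightarrow> bool" where
  "claw_free G \<longleftrightarrow> \<not> (\<exists>H. induced_subgraph H G \<and> K\<^bsub>1,3\<^esub> H)"

definition proper_coloring :: "('a, 'b) pre_digraph \<Rightarrow> ('a \<Rightarrow> 'c) \<Rightarrow> bool" where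
  "proper_coloring G c \<longleftrightarrow> (\<forall>u v. u \<rightarrow>\<^bsub>G\<^esub> v \<longrightarrow> c u \<noteq> c v)"

definition frugal_coloring :: "nat \<Rightarrow> ('a, 'b) pre_digraph \<Rightarrow> ('a \<Rightarrow> 'c) \<Rightarrow> bool" where
  "frugal_coloring t G c \<longleftrightarrow> proper_coloring G c \<and>
    (\<forall>v \<in> verts G. \<forall>i. card {u \<in> neighborhood G v. c u = i} \<le> t)"

text \<open>
  Only colors used on the vertices are counted.  For a finite graph without loops and \<open>t \<ge> 1\<close> the
  minimum is over a nonempty set, since a coloring that is injective on the vertices is \<open>t\<close>-frugal.
\<close>

definition frugal_chromatic_number :: "nat \<Rightarrow> ('a, 'b) pre_digraph \<Rightarrow> nat" where
  "frugal_chromatic_number t G =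
    (LEAST k. \<exists>c :: 'a \<Rightarrow> nat. frugal_coloring t G c \<and> card (c ` verts G) = k)"

end

theory Submission
  imports Defs
begin

text \<open>
  In a claw-free cubic graph the three neighbors of a vertex are not independent, so every vertex
  lies in a triangle.  A proper coloring therefore never gives all three neighbors of a vertex the
  same color: it is automatically 2-frugal.  As a triangle also forces three colors, what
  remains is that \<open>G\<close> is 3-colorable.  This is an instance of Brooks' theorem, and one triangle is
  enough to prove it directly.

  Let \<open>T = t\<^sub>1t\<^sub>2t\<^sub>3\<close> be a triangle and \<open>s\<^sub>i\<close> the neighbor of \<open>t\<^sub>i\<close> outside \<open>T\<close>.  If the three
  \<open>s\<^sub>i\<close> coincide, then \<open>T\<close> together with their common value is closed under adjacency, and \<open>G\<close> is
  \<open>K\<^sub>4\<close>.  Otherwise a 3-coloring of \<open>G - T\<close> extends to \<open>T\<close> as soon as it does not give all the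
  \<open>s\<^sub>i\<close> one color (lemma \<open>triangle_list_coloring\<close>), and the point is to find such a coloring (lemma
  \<open>coloring_off_triangle\<close>).

  Say \<open>s\<^sub>1 \<noteq> s\<^sub>2\<close>, and add the edge \<open>s\<^sub>1s\<^sub>2\<close> to \<open>G - T\<close>.  If greedy coloring works on the
  resulting graph, it separates \<open>s\<^sub>1\<close> from \<open>s\<^sub>2\<close>.  If it does not, some nonempty set \<open>S\<close> of
  vertices induces a subgraph of minimum degree 3.  Counting degrees shows that no edge of \<open>G - T\<close>
  leaves \<open>S\<close>, that \<open>s\<^sub>1\<close> and \<open>s\<^sub>2\<close> lie in \<open>S\<close>, and that \<open>s\<^sub>3\<close> does not.  Hence the colors on \<open>S\<close>
  can be permuted independently of the rest, which makes \<open>s\<^sub>1\<close> and \<open>s\<^sub>3\<close> differ.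
\<close>

section \<open>Colorings of a set of vertices\<close>

definition proper_on :: "nat \<Rightarrow> ('a \<Rightarrow> 'a \<Rightarrow> bool) \<Rightarrow> 'a set \<Rightarrow> ('a \<Rightarrow> nat) \<Rightarrow> bool" where
  "proper_on k R A c \<longleftrightarrow> (\<forall>v \<in> A. c v < k) \<and> (\<forall>u \<in> A. \<forall>v \<in> A. R u v \<longrightarrow> c u \<noteq> c v)"

text \<open>
  Greedy coloring: remove a vertex with fewer than \<open>k\<close> neighbors, color the rest, and give that
  vertex a color absent from its neighbors.
\<close>

lemma degenerate_imp_colorable:
  fixes R :: "'a \<Rightarrow> 'a \<Rightarrow> bool"
  assumes "finite A"
    and sym: "\<And>u v. R u v \<Longrightarrow> R v u"
    and irrefl: "\<And>v. v \<in> A \<Longrightarrow> \<not> R v v"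
    and degenerate: "\<And>S. S \<subseteq> A \<Longrightarrow> S \<noteq> {} \<Longrightarrow> \<exists>v \<in> S. card {u \<in> S. R v u} < k"
  shows "\<exists>c. proper_on k R A c"
proof -
  have "\<exists>c. proper_on k R S c" if "S \<subseteq> A" for S
    using finite_subset[OF that \<open>finite A\<close>] that
  proof (induction S rule: finite_psubset_induct)
    case (psubset S)
    show ?case
    proof (cases "S = {}")
      case True
      then show ?thesis by (simp add: proper_on_def)
    next
      case False
      then obtain v where v: "v \<in> S" "card {u \<in> S. R v u} < k"
        using degenerate psubset.prems by blast
      obtain c where c: "proper_on k R (S - {v}) c"
        using psubset.IH[of "S - {v}"] v(1) psubset.prems by blast
      let ?C = "c ` {u \<in> S. R v u}"
      have "card ?C < card {..<k}"
        using v(2) card_image_le[of "{u \<in> S. R v u}" c] psubset.hyps by simp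
      then have "\<not> {..<k} \<subseteq> ?C"
        using card_mono[of ?C "{..<k}"] psubset.hyps by auto
      then obtain x where x: "x < k" "x \<notin> ?C" by auto
      have "\<not> R v v" using irrefl v(1) psubset.prems by blast
      have fresh: "c u \<noteq> x" if "u \<in> S" "R v u" for u using x(2) that by blast
      have "proper_on k R S (c(v := x))"
        unfolding proper_on_def
      proof (intro conjI ballI impI)
        fix u assume "u \<in> S"
        then show "(c(v := x)) u < k" using c x(1) unfolding proper_on_def by simp
      next
        fix u w assume uw: "u \<in> S" "w \<in> S" "R u w"
        consider "u = v" "w \<noteq> v" | "u \<noteq> v" "w = v" | "u \<noteq> v" "w \<noteq> v"
          using uw(3) \<open>\<not> R v v\<close> by blast
        then show "(c(v := x)) u \<noteq> (c(v := x)) w"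
        proof cases
          case 1
          then show ?thesis using fresh[of w] uw by simp
        next
          case 2
          then show ?thesis using fresh[of u] uw sym by simp
        next
          case 3
          then show ?thesis using c uw unfolding proper_on_def by simp
        qed
      qed
      then show ?thesis by blast
    qed
  qed
  then show ?thesis by blast
qed

text \<open>
  The vertices of a triangle have to avoid the colors \<open>a\<close>, \<open>b\<close>, \<open>d\<close> of their outer neighbors.
  Each is left with two of three colors, and a choice of distinct ones fails to exist only when the
  three pairs are equal.
\<close>

lemma triangle_list_coloring:
  fixes a b d :: nat
  assumes "a < 3" "b < 3" "d < 3" "\<not> (a = b \<and> b = d)"
  obtains x y z :: nat where "x < 3" "y < 3" "z < 3" "x \<noteq> y" "y \<noteq> z" "x \<noteq> z" "x \<noteq> a" "y \<noteq> b" "z \<noteq> d"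
proof -
  have cases: "\<forall>a \<in> {0, 1, 2}. \<forall>b \<in> {0, 1, 2}. \<forall>d \<in> {0, 1, 2 :: nat}. \<not> (a = b \<and> b = d) \<longrightarrow>
     (\<exists>x \<in> {0, 1, 2 :: nat}. \<exists>y \<in> {0, 1, 2}. \<exists>z \<in> {0, 1, 2}.
        x \<noteq> y \<and> y \<noteq> z \<and> x \<noteq> z \<and> x \<noteq> a \<and> y \<noteq> b \<and> z \<noteq> d)"
    by simp
  have abd: "a \<in> {0, 1, 2}" "b \<in> {0, 1, 2}" "d \<in> {0, 1, 2}" using assms(1-3) by auto
  obtain x y z :: nat where "x \<in> {0, 1, 2}" "y \<in> {0, 1, 2}" "z \<in> {0, 1, 2}"
    "x \<noteq> y" "y \<noteq> z" "x \<noteq> z" "x \<noteq> a" "y \<noteq> b" "z \<noteq> d"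
    using cases[THEN bspec, OF abd(1), THEN bspec, OF abd(2), THEN bspec, OF abd(3), THEN mp, OF assms(4)]
    by (elim bexE conjE)
  then show ?thesis by (intro that[of x y z]) auto
qed

section \<open>Connected cubic graphs\<close>

locale connected_cubic_graph = graph +
  assumes connected: "connected G" and cubic: "cubic G"
begin

abbreviation adj :: "'a \<Rightarrow> 'a \<Rightarrow> bool" where "adj u v \<equiv> u \<rightarrow>\<^bsub>G\<^esub> v"
abbreviation N :: "'a \<Rightarrow> 'a set" where "N \<equiv> neighborhood G"

lemma in_N [simp]: "u \<in> N v \<longleftrightarrow> adj v u"
  by (simp add: neighborhood_def)

lemma adj_sym: "adj u v \<Longrightarrow> adj v u"
  by (rule graph_symmetric)

lemma adj_irrefl: "\<not> adj v v"
  using adj_not_same by blast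

lemma N_subset: "N v \<subseteq> verts G"
  using adj_in_verts by auto

lemma finite_N: "finite (N v)"
  using N_subset finite_verts by (rule finite_subset)

lemma card_N: "v \<in> verts G \<Longrightarrow> card (N v) = 3"
proof -
  assume v: "v \<in> verts G"
  have "N v = head G ` out_arcs G v"
    by (auto simp: arcs_ends_conv)
  moreover have "inj_on (head G) (out_arcs G v)"
    by (auto intro!: inj_onI no_multi_arcs simp: arc_to_ends_def)
  ultimately have "card (N v) = out_degree G v"
    by (simp add: card_image out_degree_def)
  then show ?thesis using cubic v by (simp add: regular_def)
qed

lemma adj_closed_eq_verts:
  assumes "S \<subseteq> verts G" "S \<noteq> {}" and closed: "\<And>u. u \<in> S \<Longrightarrow> N u \<subseteq> S"
  shows "S = verts G"
proof -
  obtain u where u: "u \<in> S" using assms(2) by blast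
  have "v \<in> S" if "v \<in> verts G" for v
  proof -
    have "u \<rightarrow>\<^sup>*\<^bsub>with_proj (mk_symmetric G)\<^esub> v"
      using connected u that assms(1) unfolding connected_def strongly_connected_def by auto
    then have "u \<rightarrow>\<^sup>* v"
      using reachable_mk_symmetric_eq[OF sym_arcs] by simp
    then show ?thesis
    proof (induction rule: reachable_induct)
      case base
      show ?case by (rule u)
    next
      case (step x y)
      then show ?case using subsetD[OF closed[of x], of y] by simp
    qed
  qed
  then show ?thesis using assms(1) by blast
qed

text \<open>
  By connectedness every nonempty \<open>S \<subseteq> A\<close> has a vertex with a neighbor outside \<open>S\<close>, hence with at
  most two neighbors in \<open>S\<close>; so the graph induced on \<open>A\<close> can be colored greedily.
\<close>

lemma proper_subset_colorable:
  assumes "A \<subset> verts G"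
  shows "\<exists>c. proper_on 3 adj A c"
proof (rule degenerate_imp_colorable)
  show "finite A" using assms finite_subset finite_verts by blast
next
  fix S assume S: "S \<subseteq> A" "S \<noteq> {}"
  then obtain v where v: "v \<in> S" "\<not> N v \<subseteq> S"
    using adj_closed_eq_verts[of S] assms by blast
  then have "{u \<in> S. adj v u} \<subset> N v" by auto
  then have "card {u \<in> S. adj v u} < card (N v)" by (rule psubset_card_mono[OF finite_N])
  then show "\<exists>v \<in> S. card {u \<in> S. adj v u} < 3"
    using card_N v(1) S(1) assms by fastforce
qed (use adj_sym adj_irrefl in auto)

lemma triangle_outer_neighbor:
  assumes "adj t u" "adj t v" "u \<noteq> v"
  obtains s where "N t = {u, v, s}" "s \<notin> {t, u, v}"
proof -
  have "card (N t) = 3" using card_N adj_in_verts assms(1) by blast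
  then have "card (N t - {u, v}) = 1"
    using assms finite_N by (subst card_Diff_subset) auto
  then obtain s where s: "N t - {u, v} = {s}" by (auto simp: card_1_singleton_iff)
  have "u \<in> N t" "v \<in> N t" using assms by simp_all
  then have "N t = {u, v, s}" using s by blast
  moreover have "s \<in> N t" "s \<notin> {u, v}" using s by blast+
  moreover from this have "s \<noteq> t" using adj_irrefl by auto
  ultimately show ?thesis by (intro that) simp_all
qed

text \<open>
  The core of the argument.  The relation \<open>R\<close> below is adjacency with the edge \<open>s\<^sub>1s\<^sub>2\<close> added.  In
  \<open>G - T\<close> each \<open>s\<^sub>i\<close> has lost a neighbor, so with the extra edge all \<open>R\<close>-degrees are still at most
  3, and a set on which greedy coloring gets stuck must contain every \<open>R\<close>-neighbor of each of its
  vertices.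
\<close>

lemma coloring_off_triangle:
  assumes tri: "adj t\<^sub>1 t\<^sub>2" "adj t\<^sub>2 t\<^sub>3" "adj t\<^sub>1 t\<^sub>3"
    and N1: "N t\<^sub>1 = {t\<^sub>2, t\<^sub>3, s\<^sub>1}" "s\<^sub>1 \<notin> {t\<^sub>1, t\<^sub>2, t\<^sub>3}"
    and N2: "N t\<^sub>2 = {t\<^sub>1, t\<^sub>3, s\<^sub>2}" "s\<^sub>2 \<notin> {t\<^sub>1, t\<^sub>2, t\<^sub>3}"
    and N3: "N t\<^sub>3 = {t\<^sub>1, t\<^sub>2, s\<^sub>3}" "s\<^sub>3 \<notin> {t\<^sub>1, t\<^sub>2, t\<^sub>3}"
    and "s\<^sub>1 \<noteq> s\<^sub>2"
  shows "\<exists>c. proper_on 3 adj (verts G - {t\<^sub>1, t\<^sub>2, t\<^sub>3}) c \<and> \<not> (c s\<^sub>1 = c s\<^sub>2 \<and> c s\<^sub>2 = c s\<^sub>3)"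
proof -
  let ?T = "{t\<^sub>1, t\<^sub>2, t\<^sub>3}"
  define A where "A = verts G - ?T"
  define R where "R u v \<longleftrightarrow> adj u v \<or> (u = s\<^sub>1 \<and> v = s\<^sub>2) \<or> (u = s\<^sub>2 \<and> v = s\<^sub>1)" for u v
  have "s\<^sub>1 \<in> N t\<^sub>1" "s\<^sub>2 \<in> N t\<^sub>2" "s\<^sub>3 \<in> N t\<^sub>3"
    unfolding N1(1) N2(1) N3(1) by simp_all
  then have adj_ts: "adj t\<^sub>1 s\<^sub>1" "adj t\<^sub>2 s\<^sub>2" "adj t\<^sub>3 s\<^sub>3" by simp_all
  then have s_A: "s\<^sub>1 \<in> A" "s\<^sub>2 \<in> A" "s\<^sub>3 \<in> A"
    using N1(2) N2(2) N3(2) adj_in_verts(2) unfolding A_def by blast+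
  have t_ne: "t\<^sub>1 \<noteq> t\<^sub>2" "t\<^sub>2 \<noteq> t\<^sub>3" "t\<^sub>1 \<noteq> t\<^sub>3" using tri adj_irrefl by auto
  have t1_verts: "t\<^sub>1 \<in> verts G" using tri adj_in_verts by blast
  have A_psub: "A \<subset> verts G" using t1_verts unfolding A_def by blast
  show ?thesis
  proof (cases "\<forall>S \<subseteq> A. S \<noteq> {} \<longrightarrow> (\<exists>v \<in> S. card {u \<in> S. R v u} < 3)")
    case True
    have "\<exists>c. proper_on 3 R A c"
    proof (rule degenerate_imp_colorable)
      show "finite A" unfolding A_def by simp
      show "R v u" if "R u v" for u v using that adj_sym unfolding R_def by blast
      show "\<not> R v v" for v using adj_irrefl \<open>s\<^sub>1 \<noteq> s\<^sub>2\<close> unfolding R_def by blast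
    qed (use True in blast)
    then obtain c where c: "proper_on 3 R A c" by blast
    then have "proper_on 3 adj A c" unfolding proper_on_def R_def by blast
    moreover have "c s\<^sub>1 \<noteq> c s\<^sub>2" using c s_A unfolding proper_on_def R_def by blast
    ultimately show ?thesis unfolding A_def by blast
  next
    case False
    then obtain S where S: "S \<subseteq> A" "S \<noteq> {}" and "\<forall>v \<in> S. \<not> card {u \<in> S. R v u} < 3"
      by blast
    then have deg: "3 \<le> card {u \<in> S. R v u}" if "v \<in> S" for v
      using that by force
    have S_verts: "S \<subseteq> verts G" using S(1) unfolding A_def by blast
    have T_S: "?T \<inter> S = {}" using S(1) unfolding A_def by blast
    \<comment> \<open>All three neighbors of an ordinary vertex of \<open>S\<close> are needed to reach degree 3 in \<open>S\<close>.\<close>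
    have plain: "N v \<subseteq> S" if "v \<in> S" "v \<noteq> s\<^sub>1" "v \<noteq> s\<^sub>2" for v
    proof -
      have "{u \<in> S. R v u} \<subseteq> N v" using that unfolding R_def by auto
      moreover have "card (N v) \<le> card {u \<in> S. R v u}"
        using card_N[of v] deg[of v] that(1) S_verts by auto
      ultimately have "{u \<in> S. R v u} = N v" by (rule card_seteq[OF finite_N])
      then show ?thesis by blast
    qed
    \<comment> \<open>An end of the added edge has only two neighbors off the triangle, so it needs both of them
      and the other end.\<close>
    have special: "insert s' (N s - {t}) \<subseteq> S"
      if "s \<in> S" "{s, s'} = {s\<^sub>1, s\<^sub>2}" "adj t s" "t \<in> ?T" for s s' t
    proof -
      let ?M = "insert s' (N s - {t})"
      have fin: "finite ?M" using finite_N by blast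
      have "{u \<in> S. R s u} \<subseteq> ?M"
      proof
        fix u assume u: "u \<in> {u \<in> S. R s u}"
        then have "u \<noteq> t" using T_S that(4) by blast
        then show "u \<in> ?M" using u that(2) \<open>s\<^sub>1 \<noteq> s\<^sub>2\<close> unfolding R_def by (auto simp: doubleton_eq_iff)
      qed
      moreover have "card ?M \<le> card {u \<in> S. R s u}"
      proof -
        have "t \<in> N s" using that(3) adj_sym by simp
        then have "card (N s - {t}) = 2" using card_N[of s] that(1) S_verts by auto
        then have "card ?M \<le> 3" using card_insert_le_m1[of 3 "N s - {t}" s'] by simp
        then show ?thesis using deg[OF that(1)] by simp
      qed
      ultimately have "{u \<in> S. R s u} = ?M" by (rule card_seteq[OF fin])
      then show ?thesis by blast
    qed
    have special1: "insert s\<^sub>2 (N s\<^sub>1 - {t\<^sub>1}) \<subseteq> S" if "s\<^sub>1 \<in> S"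
      using special[of s\<^sub>1 s\<^sub>2 t\<^sub>1] that adj_ts by blast
    have special2: "insert s\<^sub>1 (N s\<^sub>2 - {t\<^sub>2}) \<subseteq> S" if "s\<^sub>2 \<in> S"
      using special[of s\<^sub>2 s\<^sub>1 t\<^sub>2] that adj_ts by blast
    \<comment> \<open>If \<open>s\<^sub>3\<close> is neither \<open>s\<^sub>1\<close> nor \<open>s\<^sub>2\<close>, it lost \<open>t\<^sub>3\<close> and gained nothing; if it is one of
      them, it lost two neighbors and gained one.\<close>
    have s3: "s\<^sub>3 \<notin> S"
    proof
      assume in_S: "s\<^sub>3 \<in> S"
      have "t\<^sub>3 \<in> N s\<^sub>3" using adj_ts adj_sym by simp
      then have "t\<^sub>3 \<in> S"
        using plain[OF in_S] special1 special2 in_S t_ne by (cases "s\<^sub>3 = s\<^sub>1"; cases "s\<^sub>3 = s\<^sub>2") blast+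
      then show False using T_S by blast
    qed
    \<comment> \<open>Without the ends of the added edge, \<open>S\<close> would be closed under adjacency in all of \<open>G\<close>.\<close>
    have s1: "s\<^sub>1 \<in> S"
    proof (rule ccontr)
      assume "s\<^sub>1 \<notin> S"
      then have "s\<^sub>2 \<notin> S" using special2 by blast
      then have "S = verts G"
        using adj_closed_eq_verts[OF S_verts S(2)] plain \<open>s\<^sub>1 \<notin> S\<close> by blast
      then show False using t1_verts T_S by blast
    qed
    have no_edge: "v \<in> S" if "u \<in> S" "v \<in> A" "adj u v" for u v
    proof -
      have "v \<in> N u" "v \<notin> ?T" using that unfolding A_def by auto
      then show ?thesis
        using plain[OF that(1)] special1 special2 that(1) by (cases "u = s\<^sub>1"; cases "u = s\<^sub>2") blast+
    qed
    obtain c where c: "proper_on 3 adj A c" using proper_subset_colorable[OF A_psub] by blast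
    show ?thesis
    proof (cases "c s\<^sub>1 = c s\<^sub>3")
      case False
      then show ?thesis using c unfolding A_def by metis
    next
      case True
      \<comment> \<open>No edge joins \<open>S\<close> to the rest of \<open>A\<close>, so permuting the colors cyclically on \<open>S\<close> alone keeps
        the coloring proper.\<close>
      define c' where "c' v = (if v \<in> S then (c v + 1) mod 3 else c v)" for v
      have shift: "(x + 1) mod 3 \<noteq> (y + 1) mod 3" if "x < 3" "y < 3" "x \<noteq> y" for x y :: nat
        using that by presburger
      have "proper_on 3 adj A c'"
        unfolding proper_on_def
      proof (intro conjI ballI impI)
        fix v assume "v \<in> A"
        then show "c' v < 3" using c unfolding proper_on_def c'_def by simp
      next
        fix u v assume uv: "u \<in> A" "v \<in> A" "adj u v"
        then have "u \<in> S \<longleftrightarrow> v \<in> S" using no_edge adj_sym by blast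
        then show "c' u \<noteq> c' v"
          using c uv shift[of "c u" "c v"] unfolding proper_on_def c'_def by simp
      qed
      moreover have "c' s\<^sub>1 \<noteq> c' s\<^sub>3"
      proof -
        have "(x + 1) mod 3 \<noteq> x" for x :: nat by presburger
        then show ?thesis using s1 s3 True unfolding c'_def by simp
      qed
      ultimately show ?thesis unfolding A_def by metis
    qed
  qed
qed

text \<open>
  The outer neighbors of the triangle are not all equal, since a common outer neighbor would complete
  the triangle to a component \<open>K\<^sub>4\<close>.  So the rest can be colored with the outer
  neighbors not all alike, and the triangle is colored last.
\<close>

lemma triangle_imp_3_colorable:
  assumes tri: "adj t\<^sub>1 t\<^sub>2" "adj t\<^sub>2 t\<^sub>3" "adj t\<^sub>1 t\<^sub>3"
    and not_K4: "\<not> K\<^bsub>4\<^esub> G"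
  shows "\<exists>c. proper_on 3 adj (verts G) c"
proof -
  let ?T = "{t\<^sub>1, t\<^sub>2, t\<^sub>3}"
  have tri': "adj t\<^sub>2 t\<^sub>1" "adj t\<^sub>3 t\<^sub>2" "adj t\<^sub>3 t\<^sub>1" using tri adj_sym by auto
  have t_ne: "t\<^sub>1 \<noteq> t\<^sub>2" "t\<^sub>2 \<noteq> t\<^sub>3" "t\<^sub>1 \<noteq> t\<^sub>3" using tri adj_irrefl by auto
  have t_verts: "?T \<subseteq> verts G" using tri adj_in_verts by blast
  obtain s\<^sub>1 where N1: "N t\<^sub>1 = {t\<^sub>2, t\<^sub>3, s\<^sub>1}" "s\<^sub>1 \<notin> ?T"
    using triangle_outer_neighbor[of t\<^sub>1 t\<^sub>2 t\<^sub>3] tri tri' t_ne by auto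
  obtain s\<^sub>2 where N2: "N t\<^sub>2 = {t\<^sub>1, t\<^sub>3, s\<^sub>2}" "s\<^sub>2 \<notin> ?T"
    using triangle_outer_neighbor[of t\<^sub>2 t\<^sub>1 t\<^sub>3] tri tri' t_ne by auto
  obtain s\<^sub>3 where N3: "N t\<^sub>3 = {t\<^sub>1, t\<^sub>2, s\<^sub>3}" "s\<^sub>3 \<notin> ?T"
    using triangle_outer_neighbor[of t\<^sub>3 t\<^sub>1 t\<^sub>2] tri tri' t_ne by auto
  have "s\<^sub>1 \<in> N t\<^sub>1" "s\<^sub>2 \<in> N t\<^sub>2" "s\<^sub>3 \<in> N t\<^sub>3"
    unfolding N1(1) N2(1) N3(1) by simp_all
  then have adj_ts: "adj t\<^sub>1 s\<^sub>1" "adj t\<^sub>2 s\<^sub>2" "adj t\<^sub>3 s\<^sub>3" by simp_all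
  have "\<not> (s\<^sub>1 = s\<^sub>2 \<and> s\<^sub>2 = s\<^sub>3)"
  proof
    assume eq: "s\<^sub>1 = s\<^sub>2 \<and> s\<^sub>2 = s\<^sub>3"
    let ?V = "insert s\<^sub>1 ?T"
    have "adj t\<^sub>1 s\<^sub>1" "adj t\<^sub>2 s\<^sub>1" "adj t\<^sub>3 s\<^sub>1"
      using adj_ts eq by simp_all
    then have "?T \<subseteq> N s\<^sub>1" "s\<^sub>1 \<in> verts G" using adj_sym adj_in_verts by auto
    moreover have "card ?T = 3" using t_ne by simp
    ultimately have Ns: "N s\<^sub>1 = ?T" using card_N card_seteq[OF finite_N] by (metis order_refl)
    have V: "?V = verts G"
    proof (rule adj_closed_eq_verts)
      show "N u \<subseteq> ?V" if "u \<in> ?V" for u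
        using that N1(1) N2(1) N3(1) Ns eq by blast
    qed (use t_verts \<open>s\<^sub>1 \<in> verts G\<close> in auto)
    have "N t\<^sub>1 = ?V - {t\<^sub>1}" "N t\<^sub>2 = ?V - {t\<^sub>2}" "N t\<^sub>3 = ?V - {t\<^sub>3}" "N s\<^sub>1 = ?V - {s\<^sub>1}"
      unfolding N1(1) N2(1) N3(1) Ns using N1(2) N2(2) N3(2) eq t_ne by auto
    then have N_V: "N u = ?V - {u}" if "u \<in> ?V" for u using that by blast
    have "arcs_ends G = {(u, v). (u, v) \<in> verts G \<times> verts G \<and> u \<noteq> v}"
    proof -
      have "adj u v \<longleftrightarrow> u \<in> verts G \<and> v \<in> verts G \<and> u \<noteq> v" for u v
        using N_V[of u] in_N[of v u] adj_in_verts(1) unfolding V by blast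
      then show ?thesis by auto
    qed
    moreover have "card (verts G) = 4"
      unfolding V[symmetric] using N1(2) t_ne by simp
    moreover have "graph G" by unfold_locales
    ultimately show False using not_K4 unfolding complete_digraph_def by blast
  qed
  then have "\<exists>c. proper_on 3 adj (verts G - ?T) c \<and> \<not> (c s\<^sub>1 = c s\<^sub>2 \<and> c s\<^sub>2 = c s\<^sub>3)"
  proof (cases "s\<^sub>1 = s\<^sub>2")
    case False
    show ?thesis by (rule coloring_off_triangle[OF tri N1 N2 N3 False])
  next
    case True
    then have "s\<^sub>2 \<noteq> s\<^sub>3" using \<open>\<not> (s\<^sub>1 = s\<^sub>2 \<and> s\<^sub>2 = s\<^sub>3)\<close> by blast
    \<comment> \<open>Rotate the triangle so that its first two outer neighbors differ.\<close>
    have rot: "{t\<^sub>2, t\<^sub>3, t\<^sub>1} = ?T" by auto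
    have "\<exists>c. proper_on 3 adj (verts G - {t\<^sub>2, t\<^sub>3, t\<^sub>1}) c \<and> \<not> (c s\<^sub>2 = c s\<^sub>3 \<and> c s\<^sub>3 = c s\<^sub>1)"
      by (rule coloring_off_triangle) (use tri tri' N1 N2 N3 \<open>s\<^sub>2 \<noteq> s\<^sub>3\<close> in auto)
    then show ?thesis unfolding rot by metis
  qed
  then obtain c where c: "proper_on 3 adj (verts G - ?T) c"
    and ne: "\<not> (c s\<^sub>1 = c s\<^sub>2 \<and> c s\<^sub>2 = c s\<^sub>3)" by blast
  have "c s\<^sub>1 < 3" "c s\<^sub>2 < 3" "c s\<^sub>3 < 3"
    using c adj_ts N1(2) N2(2) N3(2) adj_in_verts(2) unfolding proper_on_def by blast+
  then obtain x y z :: nat where xyz: "x < 3" "y < 3" "z < 3" "x \<noteq> y" "y \<noteq> z" "x \<noteq> z"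
    "x \<noteq> c s\<^sub>1" "y \<noteq> c s\<^sub>2" "z \<noteq> c s\<^sub>3"
    using triangle_list_coloring ne by metis
  define c' where "c' = c(t\<^sub>1 := x, t\<^sub>2 := y, t\<^sub>3 := z)"
  have on_T: "c' u \<noteq> c' v" if "u \<in> ?T" "v \<in> N u" for u v
  proof -
    have "\<forall>v \<in> N t\<^sub>1. c' t\<^sub>1 \<noteq> c' v" "\<forall>v \<in> N t\<^sub>2. c' t\<^sub>2 \<noteq> c' v" "\<forall>v \<in> N t\<^sub>3. c' t\<^sub>3 \<noteq> c' v"
      unfolding N1(1) N2(1) N3(1) c'_def using N1(2) N2(2) N3(2) xyz t_ne by auto
    then show ?thesis using that by blast
  qed
  have "proper_on 3 adj (verts G) c'"
    unfolding proper_on_def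
  proof (intro conjI ballI impI)
    fix v assume "v \<in> verts G"
    then show "c' v < 3" using c xyz unfolding proper_on_def c'_def by auto
  next
    fix u v assume uv: "u \<in> verts G" "v \<in> verts G" "adj u v"
    show "c' u \<noteq> c' v"
    proof (cases "u \<in> ?T \<or> v \<in> ?T")
      case True
      then show ?thesis using on_T[of u v] on_T[of v u] uv(3) adj_sym[OF uv(3)] by (metis in_N)
    next
      case False
      then show ?thesis using c uv unfolding proper_on_def c'_def by auto
    qed
  qed
  then show ?thesis by blast
qed

section \<open>Claw-freeness\<close>

text \<open>If the three neighbors were pairwise nonadjacent, they would induce a claw together with \<open>v\<close>.\<close>

lemma claw_free_adjacent_neighbors:
  assumes "claw_free G" "v \<in> verts G"
  shows "\<exists>a \<in> N v. \<exists>b \<in> N v. adj a b"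
proof (rule ccontr)
  assume indep: "\<not> ?thesis"
  let ?H = "G \<restriction> insert v (N v)"
  have sub: "insert v (N v) \<subseteq> verts G" using N_subset[of v] assms(2) by simp
  have ind: "induced_subgraph ?H G" by (rule induced_induce[OF sub])
  have "graph ?H"
    using digraphI_induced[OF ind] induced_graph_imp_graph[OF ind]
    by (simp add: digraph.graphI sym_digraph.sym_arcs)
  moreover have "arcs_ends ?H = {v} \<times> N v \<union> N v \<times> {v}"
  proof -
    have "(a, b) \<in> arcs_ends ?H \<longleftrightarrow> a = v \<and> b \<in> N v \<or> a \<in> N v \<and> b = v" for a b
    proof -
      have "(a, b) \<in> arcs_ends ?H \<longleftrightarrow> adj a b \<and> a \<in> insert v (N v) \<and> b \<in> insert v (N v)"
        by (auto simp: arcs_ends_conv)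
      moreover have "\<not> adj a b" if "a \<in> N v" "b \<in> N v"
        using indep that by blast
      ultimately show ?thesis
        using adj_sym[of a v] adj_sym[of v a] adj_irrefl[of v] by auto
    qed
    then show ?thesis by (simp add: set_eq_iff)
  qed
  ultimately have "K\<^bsub>1,3\<^esub> ?H"
    unfolding complete_bipartite_digraph_def
    using card_N[OF assms(2)] adj_irrefl by (intro conjI exI[of _ "{v}"] exI[of _ "N v"]) auto
  then show False using ind assms(1) unfolding claw_free_def by blast
qed

end

theorem proposition4p3:
  fixes G :: "('a, 'b) pre_digraph"
  assumes "graph G"
    and "connected G"
    and "claw_free G"
    and "cubic G"
    and "\<not> K\<^bsub>4\<^esub> G"
  shows "frugal_chromatic_number 2 G = 3"
proof -
  interpret connected_cubic_graph G
    using assms by (simp add: connected_cubic_graph_def connected_cubic_graph_axioms_def)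
  obtain t\<^sub>1 where t1: "t\<^sub>1 \<in> verts G"
    using connected unfolding connected_def strongly_connected_def by auto
  obtain t\<^sub>2 t\<^sub>3 where tri: "adj t\<^sub>1 t\<^sub>2" "adj t\<^sub>2 t\<^sub>3" "adj t\<^sub>1 t\<^sub>3"
    using claw_free_adjacent_neighbors[OF assms(3) t1] by auto
  have at_least_3: "3 \<le> card (c ` verts G)" if "frugal_coloring 2 G c" for c :: "'a \<Rightarrow> nat"
  proof -
    have "card {c t\<^sub>1, c t\<^sub>2, c t\<^sub>3} = 3"
      using that tri unfolding frugal_coloring_def proper_coloring_def by auto
    moreover have "{c t\<^sub>1, c t\<^sub>2, c t\<^sub>3} \<subseteq> c ` verts G"
      using tri adj_in_verts by blast
    ultimately show ?thesis using card_mono[of "c ` verts G"] by (metis finite_imageI finite_verts)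
  qed
  obtain c where c: "proper_on 3 adj (verts G) c"
    using triangle_imp_3_colorable[OF tri assms(5)] by blast
  have proper: "proper_coloring G c"
    using c adj_in_verts unfolding proper_on_def proper_coloring_def by blast
  have frugal: "frugal_coloring 2 G c"
    unfolding frugal_coloring_def
  proof (intro conjI ballI allI proper)
    fix v i assume v: "v \<in> verts G"
    obtain a b where ab: "a \<in> N v" "b \<in> N v" "adj a b"
      using claw_free_adjacent_neighbors[OF assms(3) v] by blast
    then have "c a \<noteq> c b" using proper unfolding proper_coloring_def by blast
    then have "a \<notin> {u \<in> N v. c u = i} \<or> b \<notin> {u \<in> N v. c u = i}" by simp
    then have "{u \<in> N v. c u = i} \<subset> N v" using ab(1,2) by blast
    then have "card {u \<in> N v. c u = i} < card (N v)" by (rule psubset_card_mono[OF finite_N])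
    then show "card {u \<in> N v. c u = i} \<le> 2" using card_N[OF v] by simp
  qed
  have "c ` verts G \<subseteq> {..<3}" using c unfolding proper_on_def by auto
  then have "card (c ` verts G) \<le> 3" using card_mono[of "{..<3 :: nat}"] by fastforce
  then have "card (c ` verts G) = 3" using at_least_3[OF frugal] by simp
  then show ?thesis
    unfolding frugal_chromatic_number_def using frugal at_least_3
    by (intro Least_equality) auto
qed

end
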